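(* Let $f:\mathbb{N}\to\mathbb{Z}$ satisfy $0\le f(n)\le n$ for all $n$, and suppose \[ \lim_{n\to\infty}\frac{f(n)\log\log n}{n}=\infty. \] Then there exists a function $\Psi:\mathbb{N}\to\mathbb{R}_{\geq0}$ such that $\sum_{n=1}^\infty f(n)\Psi(n)$ diverges, yet $\lambda(W(\Psi))=0$.
   Context: $[n]=\{1,\dots,n\}$. For $\Psi:\mathbb{N}\to\mathbb{R}_{\ge0}$, $W(\Psi)$ is the set of $x\in[0,1]$ such that $|x-a/n|<\Psi(n)$ for infinitely many pairs $(n,a)$ with $n\in\mathbb{N}$, $a\in[n]$. $\lambda$ is Lebesgue measure. *)

theory Defs
  imports "HOL-Analysis.Analysis"
begin

text \<open>The natural numbers start at \<open>1\<close>: index \<open>0\<close> of a function on \<^typ>\<open>nat\<close> plays no role.\<close>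

definition W :: "(nat \<Rightarrow> real) \<Rightarrow> real set" where
  "W \<Psi> = {x \<in> {0..1}.
     infinite {(n, a). n \<ge> 1 \<and> a \<in> {1..n} \<and> \<bar>x - real a / real n\<bar> < \<Psi> n}}"

end

theory Submission
  imports Defs
begin

text \<open>
  For \<open>N = y!\<close>, every fraction whose denominator divides \<open>N\<close> is a multiple of \<open>1/N\<close>, so giving
  all divisors \<open>n = N/d\<close> with \<open>d \<le> y\<close> the same radius \<open>\<epsilon>/N\<close> covers only measure \<open>2\<epsilon>\<close>. On the
  other hand \<open>\<Sum>n/N = \<Sum>1/d \<ge> log y \<ge> (log log N)/2\<close> over these divisors, so if \<open>f n \<ge> C n / log log n\<close>
  on them, they contribute at least \<open>C\<epsilon>/2\<close> to the series. Taking \<open>\<epsilon> = 2\<^sup>-\<^sup>k\<close> and \<open>C = 2\<^sup>k\<close> for a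
  rapidly growing sequence of values \<open>y\<^sub>k\<close>, the series diverges, while the exceptional set is null
  by Borel--Cantelli.
\<close>

lemma filterlim_at_top_strict_mono_thresholds:
  fixes F :: "nat \<Rightarrow> 'a::linorder"
  assumes "filterlim F at_top sequentially"
  obtains M :: "nat \<Rightarrow> nat" where "strict_mono M" "\<And>k n. M k \<le> n \<Longrightarrow> B k \<le> F n"
proof -
  have "\<exists>m. \<forall>n\<ge>m. B k \<le> F n" for k
    using assms unfolding filterlim_at_top eventually_sequentially by blast
  then obtain m where m: "\<And>k n. m k \<le> n \<Longrightarrow> B k \<le> F n"
    by metis
  define M where "M k = k + (\<Sum>i\<le>k. m i)" for k
  have m_le_M: "m k \<le> M k" for k
    using member_le_sum[of k "{..k}" m] by (simp add: M_def)
  show thesis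
  proof (rule that)
    show "strict_mono M"
      by (simp add: strict_mono_Suc_iff M_def)
    show "B k \<le> F n" if "M k \<le> n" for k n
      using that by (intro m order_trans[OF m_le_M])
  qed
qed

lemma not_summable_if_tail_sums_ge:
  fixes h :: "nat \<Rightarrow> real"
  assumes "0 < \<delta>"
    and nonneg: "\<And>n. n\<^sub>0 \<le> n \<Longrightarrow> 0 \<le> h n"
    and tail_sums: "\<And>m. \<exists>A. finite A \<and> A \<subseteq> {m..} \<and> \<delta> \<le> sum h A"
  shows "\<not> summable h"
proof
  assume "summable h"
  with \<open>0 < \<delta>\<close> obtain N where N: "\<And>m n. N \<le> m \<Longrightarrow> norm (sum h {m..<n}) < \<delta>"
    unfolding summable_Cauchy by blast
  define m where "m = max N n\<^sub>0"
  obtain A where A: "finite A" "A \<subseteq> {m..}" "\<delta> \<le> sum h A"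
    using tail_sums by blast
  then obtain b where "A \<subseteq> {..<b}"
    using finite_nat_iff_bounded by blast
  with A(2) have "A \<subseteq> {m..<b}"
    by auto
  then have "sum h A \<le> sum h {m..<b}"
    using nonneg by (intro sum_mono2) (auto simp: m_def)
  with A(3) N[of m b] show False
    by (simp add: m_def)
qed

definition value_at_least_index ::
    "(nat \<Rightarrow> 'a set) \<Rightarrow> (nat \<Rightarrow> 'b::{zero,order}) \<Rightarrow> 'a \<Rightarrow> 'b" where
  "value_at_least_index S r x = (if x \<in> (\<Union>k. S k) then r (LEAST k. x \<in> S k) else 0)"

lemma value_at_least_index_nonneg:
  assumes "\<And>k. 0 \<le> r k"
  shows "0 \<le> value_at_least_index S r x"
  using assms by (simp add: value_at_least_index_def)

lemma value_at_least_index_ge: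
  assumes "antimono r" "x \<in> S k"
  shows "r k \<le> value_at_least_index S r x"
  using assms antimonoD[OF _ Least_le[of "\<lambda>k. x \<in> S k" k], of r]
  by (auto simp: value_at_least_index_def)

lemma value_at_least_index_posE:
  assumes "0 < value_at_least_index S r x"
  obtains k where "x \<in> S k" "value_at_least_index S r x = r k"
proof -
  obtain j where "x \<in> S j"
    using assms by (auto simp: value_at_least_index_def split: if_splits)
  then have "x \<in> S (LEAST k. x \<in> S k)"
    by (rule LeastI)
  then show thesis
    by (rule that) (use \<open>x \<in> S j\<close> in \<open>auto simp: value_at_least_index_def\<close>)
qed

lemma ln_ln_fact_le:
  assumes "2 \<le> y"
  shows "ln (ln (fact y :: real)) \<le> 2 * ln (real y)"
proof -
  have "real y \<le> fact y"
    by (metis fact_ge_self of_nat_fact of_nat_mono)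
  then have fact_gt_1: "(fact y :: real) > 1"
    using assms by linarith
  have "(fact y :: real) \<le> real y ^ y"
    by (metis fact_le_power of_nat_power)
  then have "ln (fact y :: real) \<le> ln (real y ^ y)"
    using fact_gt_1 by (intro ln_mono) auto
  also have "\<dots> = real y * ln (real y)"
    by (simp add: ln_realpow)
  also have "\<dots> \<le> real y * real y"
    using assms by (intro mult_left_mono) (auto intro: less_imp_le ln_less_self)
  finally have "ln (ln (fact y :: real)) \<le> ln (real y * real y)"
    using fact_gt_1 by (intro ln_mono) auto
  also have "\<dots> = 2 * ln (real y)"
    using assms by (simp add: ln_mult)
  finally show ?thesis .
qed

lemma inj_on_div_divisors:
  fixes N :: nat
  assumes "0 < N"
  shows "inj_on ((div) N) {d. d dvd N}"
proof (rule inj_onI)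
  fix d e
  assume "d \<in> {d. d dvd N}" "e \<in> {d. d dvd N}"
  then have "d * (N div d) = N" "e * (N div e) = N"
    by auto
  moreover assume "N div d = N div e"
  ultimately show "d = e"
    using assms by (metis mult_cancel2 mult_0_right less_irrefl)
qed

definition cofactors :: "nat \<Rightarrow> nat set" where
  "cofactors y = (div) (fact y) ` {1..y}"

lemma finite_cofactors: "finite (cofactors y)"
  by (simp add: cofactors_def)

lemma cofactors_dvd_fact:
  assumes "n \<in> cofactors y"
  shows "n dvd fact y"
proof -
  obtain d where "d \<in> {1..y}" "n = fact y div d"
    using assms by (auto simp: cofactors_def)
  then have "d * n = fact y"
    by (simp add: dvd_fact)
  then show ?thesis
    by (metis dvd_triv_right)
qed

lemma cofactors_ge:
  assumes "n \<in> cofactors y"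
  shows "y - 1 \<le> n"
proof -
  obtain d where d: "1 \<le> d" "d \<le> y" and n: "n = fact y div d"
    using assms by (auto simp: cofactors_def)
  have "d * fact (y - 1) \<le> (fact y :: nat)"
    using d fact_reduce[of y, where ?'a = nat] by simp
  then have "fact (y - 1) \<le> n"
    using d n by (simp add: less_eq_div_iff_mult_less_eq mult.commute)
  then show ?thesis
    using fact_ge_self[of "y - 1"] by linarith
qed

lemma sum_cofactors: "(\<Sum>n\<in>cofactors y. real n) = fact y * harm y"
proof -
  have dvd: "d dvd (fact y :: nat)" if "d \<in> {1..y}" for d
    using that by (intro dvd_fact) auto
  have "inj_on ((div) (fact y :: nat)) {1..y}"
    by (rule inj_on_subset[OF inj_on_div_divisors]) (auto intro: dvd)
  then have "(\<Sum>n\<in>cofactors y. real n) = (\<Sum>d=1..y. real (fact y div d))"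
    by (simp add: cofactors_def sum.reindex)
  also have "\<dots> = (\<Sum>d=1..y. fact y * inverse (real d))"
    by (intro sum.cong refl) (simp add: real_of_nat_div dvd divide_inverse)
  finally show ?thesis
    by (simp add: harm_def sum_distrib_left)
qed

lemma sum_cofactors_ge:
  assumes "0 < y"
  shows "fact y * ln (real y) \<le> (\<Sum>n\<in>cofactors y. real n)"
proof -
  have "ln (real y) \<le> ln (real y + 1)"
    using assms by simp
  also have "\<dots> \<le> harm y"
    by (rule ln_le_harm)
  finally show ?thesis
    by (simp add: sum_cofactors)
qed

lemma one_less_ln_cofactor:
  assumes "4 \<le> y" "n \<in> cofactors y"
  shows "1 < ln (real n)"
proof -
  have "ln 3 \<le> ln (real n)"
    using cofactors_ge[OF assms(2)] assms(1) by (intro ln_mono) auto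
  then show ?thesis
    using ln3_gt_1 by linarith
qed

lemma ln_ln_cofactor_le:
  assumes "4 \<le> y" "n \<in> cofactors y"
  shows "ln (ln (real n)) \<le> 2 * ln (real y)"
proof -
  have "1 < ln (real n)"
    by (rule one_less_ln_cofactor[OF assms])
  moreover have "1 < n"
    using cofactors_ge[OF assms(2)] assms(1) by linarith
  moreover have "n \<le> fact y"
    using cofactors_dvd_fact[OF assms(2)] by (simp add: dvd_imp_le)
  then have "real n \<le> fact y"
    by (metis of_nat_fact of_nat_mono)
  ultimately have "ln (ln (real n)) \<le> ln (ln (fact y))"
    by (intro ln_mono) auto
  also have "\<dots> \<le> 2 * ln (real y)"
    using assms(1) by (intro ln_ln_fact_le) simp
  finally show ?thesis .
qed

lemma cofactor_linear_lower_bound: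
  assumes "4 \<le> y" "n \<in> cofactors y" "0 \<le> C" "C \<le> a * ln (ln (real n)) / real n"
  shows "C / (2 * ln (real y)) * real n \<le> a"
proof -
  have "0 < n"
    using cofactors_ge[OF assms(2)] assms(1) by linarith
  have "0 \<le> C * real n"
    using assms(3) by simp
  also have C_le: "C * real n \<le> a * ln (ln (real n))"
    using assms(4) \<open>0 < n\<close> by (simp add: field_simps)
  finally have "0 \<le> a"
    using one_less_ln_cofactor[OF assms(1,2)] by (simp add: zero_le_mult_iff)
  with ln_ln_cofactor_le[OF assms(1,2)] have "a * ln (ln (real n)) \<le> a * (2 * ln (real y))"
    by (rule mult_left_mono)
  with C_le have "C * real n \<le> a * (2 * ln (real y))"
    by (rule order_trans)
  then show ?thesis
    using assms(1) by (simp add: field_simps)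
qed

lemma weighted_sum_cofactors_ge:
  assumes "4 \<le> y" "0 \<le> C"
    and g_ge: "\<And>n. n \<in> cofactors y \<Longrightarrow> C \<le> g n * ln (ln (real n)) / real n"
    and \<Psi>_ge: "\<And>n. n \<in> cofactors y \<Longrightarrow> \<epsilon> / fact y \<le> \<Psi> n"
    and "0 \<le> \<epsilon>"
  shows "C * \<epsilon> / 2 \<le> (\<Sum>n\<in>cofactors y. g n * \<Psi> n)"
proof -
  define K where "K = C / (2 * ln (real y))"
  have "0 < ln (real y)"
    using assms(1) by simp
  then have "0 \<le> K" and K_ln: "K * ln (real y) = C / 2"
    using assms(2) by (simp_all add: K_def)
  have "C * \<epsilon> / 2 = K * (\<epsilon> / fact y) * (fact y * ln (real y))"
    using K_ln by (simp add: mult_ac)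
  also have "\<dots> \<le> K * (\<epsilon> / fact y) * (\<Sum>n\<in>cofactors y. real n)"
    using assms(1) \<open>0 \<le> K\<close> \<open>0 \<le> \<epsilon>\<close> by (intro mult_left_mono sum_cofactors_ge) auto
  also have "\<dots> = (\<Sum>n\<in>cofactors y. K * real n * (\<epsilon> / fact y))"
    by (simp add: sum_distrib_left sum_divide_distrib mult_ac)
  also have "\<dots> \<le> (\<Sum>n\<in>cofactors y. g n * \<Psi> n)"
  proof (rule sum_mono)
    fix n
    assume n: "n \<in> cofactors y"
    have K_le: "K * real n \<le> g n"
      unfolding K_def using assms(1) n assms(2) g_ge[OF n] by (rule cofactor_linear_lower_bound)
    moreover have "0 \<le> g n"
      using \<open>0 \<le> K\<close> by (intro order_trans[OF _ K_le]) simp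
    ultimately show "K * real n * (\<epsilon> / fact y) \<le> g n * \<Psi> n"
      using \<Psi>_ge[OF n] \<open>0 \<le> \<epsilon>\<close> by (intro mult_mono) auto
  qed
  finally show ?thesis .
qed

definition rational_nbhd :: "nat \<Rightarrow> real \<Rightarrow> real set" where
  "rational_nbhd n r = (\<Union>a\<in>{1..n}. ball (real a / real n) r)"

lemma rational_nbhd_lmeasurable: "rational_nbhd n r \<in> lmeasurable"
  unfolding rational_nbhd_def by (intro fmeasurable.finite_UN) auto

lemma measure_rational_nbhd_le:
  assumes "0 \<le> r"
  shows "measure lebesgue (rational_nbhd n r) \<le> 2 * (real n * r)"
proof -
  have "measure lebesgue (rational_nbhd n r)
      \<le> (\<Sum>a=1..n. measure lebesgue (ball (real a / real n) r))"
    unfolding rational_nbhd_def by (intro measure_UNION_le) auto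
  also have "\<dots> = 2 * (real n * r)"
    using assms by (simp add: ball_eq_greaterThanLessThan)
  finally show ?thesis .
qed

lemma rational_nbhd_mono:
  assumes "r \<le> s"
  shows "rational_nbhd n r \<subseteq> rational_nbhd n s"
  unfolding rational_nbhd_def using assms by (intro UN_mono subset_ball) auto

lemma rational_nbhd_mono_dvd:
  assumes "n dvd N" "0 < N"
  shows "rational_nbhd n r \<subseteq> rational_nbhd N r"
proof
  fix x
  assume "x \<in> rational_nbhd n r"
  then obtain a where a: "a \<in> {1..n}" "x \<in> ball (real a / real n) r"
    by (auto simp: rational_nbhd_def)
  obtain d where N: "N = n * d"
    using assms(1) by blast
  then have "d * a \<in> {1..N}" "real (d * a) / real N = real a / real n"
    using a(1) assms(2) by auto
  with a(2) show "x \<in> rational_nbhd N r"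
    unfolding rational_nbhd_def by (metis UN_I)
qed

lemma infinite_rational_nbhds_if_mem_W:
  assumes "x \<in> W \<Psi>"
  shows "infinite {n. x \<in> rational_nbhd n (\<Psi> n)}"
proof
  assume "finite {n. x \<in> rational_nbhd n (\<Psi> n)}"
  then have "finite (SIGMA n:{n. x \<in> rational_nbhd n (\<Psi> n)}. {1..n})"
    by simp
  then have "finite {(n, a). n \<ge> 1 \<and> a \<in> {1..n} \<and> \<bar>x - real a / real n\<bar> < \<Psi> n}"
    by (rule finite_subset[rotated]) (force simp: rational_nbhd_def dist_real_def abs_minus_commute)
  with assms show False
    by (simp add: W_def)
qed

lemma limsup_rational_nbhd_null_sets:
  assumes "\<And>k. 0 \<le> r k" and "summable (\<lambda>k. real (N k) * r k)"
  shows "limsup (\<lambda>k. rational_nbhd (N k) (r k)) \<in> null_sets lebesgue"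
proof (rule borel_cantelli_limsup1)
  have "norm (measure lebesgue (rational_nbhd (N k) (r k))) \<le> 2 * (real (N k) * r k)" for k
    using measure_rational_nbhd_le[OF assms(1)] by simp
  then show "summable (\<lambda>k. measure lebesgue (rational_nbhd (N k) (r k)))"
    using summable_mult[OF assms(2)] by (rule summable_comparison_test'[rotated])
  show "rational_nbhd (N k) (r k) \<in> sets lebesgue"
    and "emeasure lebesgue (rational_nbhd (N k) (r k)) < \<infinity>" for k
    using rational_nbhd_lmeasurable[of "N k" "r k"]
    by (simp_all only: fmeasurable_def mem_Collect_eq)
qed

lemma W_subset_limsup_rational_nbhd:
  assumes N_pos: "\<And>k. 0 < N k"
    and dominated: "\<And>n. 1 \<le> n \<Longrightarrow> 0 < \<Psi> n \<Longrightarrow> \<exists>k. n dvd N k \<and> \<Psi> n \<le> r k"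
  shows "W \<Psi> \<subseteq> limsup (\<lambda>k. rational_nbhd (N k) (r k))"
proof
  fix x
  assume "x \<in> W \<Psi>"
  define I where "I = {k. x \<in> rational_nbhd (N k) (r k)}"
  have covered: "\<exists>k\<in>I. n dvd N k" if "x \<in> rational_nbhd n (\<Psi> n)" for n
  proof -
    have "1 \<le> n" "0 < \<Psi> n"
      using that by (force simp: rational_nbhd_def intro: le_less_trans[OF zero_le_dist])+
    then obtain k where "n dvd N k" "\<Psi> n \<le> r k"
      using dominated by blast
    then show ?thesis
      using that N_pos rational_nbhd_mono rational_nbhd_mono_dvd unfolding I_def by blast
  qed
  have "infinite I"
  proof
    assume "finite I"
    then have "finite (\<Union>k\<in>I. {n. n dvd N k})"
      using N_pos by (auto intro: finite_divisors_nat)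
    then have "finite {n. x \<in> rational_nbhd n (\<Psi> n)}"
      by (rule finite_subset[rotated]) (use covered in blast)
    with infinite_rational_nbhds_if_mem_W[OF \<open>x \<in> W \<Psi>\<close>] show False ..
  qed
  then show "x \<in> limsup (\<lambda>k. rational_nbhd (N k) (r k))"
    unfolding mem_limsup_iff I_def
    by (simp add: frequently_cofinite flip: cofinite_eq_sequentially)
qed

text \<open>
  The blocks \<open>cofactors (y k)\<close> may overlap; as the radii decrease, the least index gives the
  largest one.
\<close>

definition cofactor_radius :: "(nat \<Rightarrow> nat) \<Rightarrow> nat \<Rightarrow> real" where
  "cofactor_radius y =
    value_at_least_index (\<lambda>k. cofactors (y k)) (\<lambda>k. (1/2) ^ k / fact (y k))"

lemma cofactor_radius_nonneg: "0 \<le> cofactor_radius y n"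
  unfolding cofactor_radius_def by (rule value_at_least_index_nonneg) simp

lemma cofactor_radius_ge:
  assumes "mono y" "n \<in> cofactors (y k)"
  shows "(1/2) ^ k / fact (y k) \<le> cofactor_radius y n"
  unfolding cofactor_radius_def
proof (rule value_at_least_index_ge)
  show "antimono (\<lambda>k. (1/2) ^ k / fact (y k) :: real)"
    by (intro antimonoI frac_le power_decreasing fact_mono monoD[OF \<open>mono y\<close>]) auto
  show "n \<in> cofactors (y k)"
    by fact
qed

lemma W_cofactor_radius_null_sets: "W (cofactor_radius y) \<in> null_sets lebesgue"
proof (rule null_sets_completion_subset)
  let ?r = "\<lambda>k. (1/2) ^ k / fact (y k) :: real"
  show "limsup (\<lambda>k. rational_nbhd (fact (y k)) (?r k)) \<in> null_sets lebesgue"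
    by (rule limsup_rational_nbhd_null_sets) (simp_all add: summable_geometric)
  show "W (cofactor_radius y) \<subseteq> limsup (\<lambda>k. rational_nbhd (fact (y k)) (?r k))"
  proof (rule W_subset_limsup_rational_nbhd)
    fix n
    assume "0 < cofactor_radius y n"
    then obtain k where "n \<in> cofactors (y k)" "cofactor_radius y n = ?r k"
      unfolding cofactor_radius_def by (rule value_at_least_index_posE)
    then show "\<exists>k. n dvd fact (y k) \<and> cofactor_radius y n \<le> ?r k"
      using cofactors_dvd_fact by auto
  qed simp
qed

lemma not_summable_mult_cofactor_radius:
  assumes "mono y" and y_ge: "\<And>k. k + 4 \<le> y k"
    and g_nonneg: "\<And>n. 1 \<le> n \<Longrightarrow> 0 \<le> g n"
    and g_ge: "\<And>k n. y k - 1 \<le> n \<Longrightarrow> 2 ^ k \<le> g n * ln (ln (real n)) / real n"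
  shows "\<not> summable (\<lambda>n. g n * cofactor_radius y n)"
proof (rule not_summable_if_tail_sums_ge)
  show "0 \<le> g n * cofactor_radius y n" if "1 \<le> n" for n
    using g_nonneg[OF that] cofactor_radius_nonneg by simp
  show "\<exists>A. finite A \<and> A \<subseteq> {k..} \<and> 1/2 \<le> (\<Sum>n\<in>A. g n * cofactor_radius y n)" for k
  proof (intro exI conjI)
    show "finite (cofactors (y k))"
      by (rule finite_cofactors)
    show "cofactors (y k) \<subseteq> {k..}"
      using cofactors_ge y_ge[of k] by fastforce
    have "2 ^ k * (1/2) ^ k / 2 \<le> (\<Sum>n\<in>cofactors (y k). g n * cofactor_radius y n)"
    proof (rule weighted_sum_cofactors_ge)
      show "4 \<le> y k"
        using y_ge[of k] by simp
      show "2 ^ k \<le> g n * ln (ln (real n)) / real n" if "n \<in> cofactors (y k)" for n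
        by (rule g_ge[OF cofactors_ge[OF that]])
      show "(1/2) ^ k / fact (y k) \<le> cofactor_radius y n" if "n \<in> cofactors (y k)" for n
        by (rule cofactor_radius_ge[OF \<open>mono y\<close> that])
    qed simp_all
    then show "1/2 \<le> (\<Sum>n\<in>cofactors (y k). g n * cofactor_radius y n)"
      by (simp add: power_one_over)
  qed
qed simp

theorem theorem1p8:
  fixes f :: "nat \<Rightarrow> int"
  assumes "\<And>n. n \<ge> 1 \<Longrightarrow> 0 \<le> f n \<and> f n \<le> int n"
    and "filterlim (\<lambda>n. real_of_int (f n) * ln (ln (real n)) / real n) at_top sequentially"
  shows "\<exists>\<Psi> :: nat \<Rightarrow> real.
           (\<forall>n\<ge>1. 0 \<le> \<Psi> n) \<and>
           \<not> summable (\<lambda>n. real_of_int (f (Suc n)) * \<Psi> (Suc n)) \<and>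
           W \<Psi> \<in> null_sets lebesgue"
proof -
  obtain M :: "nat \<Rightarrow> nat" where "strict_mono M"
    and M: "\<And>k n. M k \<le> n \<Longrightarrow> 2 ^ k \<le> real_of_int (f n) * ln (ln (real n)) / real n"
    using filterlim_at_top_strict_mono_thresholds[where B = "\<lambda>k. 2 ^ k", OF assms(2)]
    by blast
  define y where "y k = M k + 4" for k
  have "\<not> summable (\<lambda>n. real_of_int (f n) * cofactor_radius y n)"
  proof (rule not_summable_mult_cofactor_radius)
    show "mono y"
      using \<open>strict_mono M\<close> by (auto simp: y_def mono_def strict_mono_less_eq)
    show "k + 4 \<le> y k" for k
      using strict_mono_imp_increasing[OF \<open>strict_mono M\<close>, of k] by (simp add: y_def)
    show "2 ^ k \<le> real_of_int (f n) * ln (ln (real n)) / real n" if "y k - 1 \<le> n" for k n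
      using that by (intro M) (simp add: y_def)
  qed (use assms(1) in simp)
  then have "\<not> summable (\<lambda>n. real_of_int (f (Suc n)) * cofactor_radius y (Suc n))"
    by (subst summable_Suc_iff)
  then show ?thesis
    using cofactor_radius_nonneg W_cofactor_radius_null_sets by blast
qed

end
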